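(* The positional marked patterns $\underline{1}23$ and $\underline{1}32$ are $pmp$-Wilf equivalent; that is, for every $n\ge 1$, $$\sum_{\sigma\in S_n} x^{pmp_{\underline{1}23}(\sigma)}=\sum_{\sigma\in S_n} x^{pmp_{\underline{1}32}(\sigma)}.$$
   Context: A positional marked pattern of length $k$ is a permutation $\tau=\tau_1\cdots\tau_k$ of $[k]$ with exactly one entry underlined; $\pi(\tau)\in S_k$ is the permutation obtained by removing the underline and $u(\tau)$ is the position of the underlined entry. For a word $w$ with distinct letters, $red(w)$ replaces the $i$-th smallest letter by $i$. For $\sigma=\sigma_1\cdots\sigma_n\in S_n$, $\sigma$ has a $\tau$-match at position $\ell$ if there are indices $i_1<\cdots<i_k$ with $i_{u(\tau)}=\ell$ and $red(\sigma_{i_1}\cdots\sigma_{i_k})=\pi(\tau)$. $pmp_\tau(\sigma)$ is the number of positions $\ell$ at which $\sigma$ has a $\tau$-match. Two positional marked patterns $\tau,\tau'$ are $pmp$-Wilf equivalent if $\sum_{\sigma\in S_n}x^{pmp_\tau(\sigma)}=\sum_{\sigma\in S_n}x^{pmp_{\tau'}(\sigma)}$ for all $n$. Thus $\underline{1}23$ is the pattern with $\pi=123$, $u=1$, and $\underline{1}32$ the pattern with $\pi=132$, $u=1$. *)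

theory Defs
  imports
    "HOL-Combinatorics.Multiset_Permutations"
    "HOL-Computational_Algebra.Polynomial"
begin

text \<open>
  Permutations of \<open>{1..n}\<close> are words in one-line notation, i.e. elements of
  \<^term>\<open>permutations_of_set {1..n}\<close>. Positions in words are counted from 1.
\<close>

definition letter :: "nat list \<Rightarrow> nat \<Rightarrow> nat" where
  "letter w i = w ! (i - 1)"

definition red :: "nat list \<Rightarrow> nat list" where
  "red w = map (\<lambda>a. card {b \<in> set w. b \<le> a}) w"

text \<open>The second component is the position of the underlined entry.\<close>

datatype marked_pattern = Marked (perm_of: "nat list") (mark_of: nat)

definition positional_marked_pattern :: "marked_pattern \<Rightarrow> bool" where
  "positional_marked_pattern \<tau> \<longleftrightarrow>
     perm_of \<tau> \<in> permutations_of_set {1..length (perm_of \<tau>)} \<and>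
     mark_of \<tau> \<in> {1..length (perm_of \<tau>)}"

definition has_match_at :: "marked_pattern \<Rightarrow> nat list \<Rightarrow> nat \<Rightarrow> bool" where
  "has_match_at \<tau> \<sigma> l \<longleftrightarrow>
     (\<exists>ps. length ps = length (perm_of \<tau>) \<and> set ps \<subseteq> {1..length \<sigma>} \<and>
           sorted_wrt (<) ps \<and> letter ps (mark_of \<tau>) = l \<and>
           red (map (letter \<sigma>) ps) = perm_of \<tau>)"

definition pmp :: "marked_pattern \<Rightarrow> nat list \<Rightarrow> nat" where
  "pmp \<tau> \<sigma> = card {l \<in> {1..length \<sigma>}. has_match_at \<tau> \<sigma> l}"

definition pmp_poly :: "marked_pattern \<Rightarrow> nat \<Rightarrow> int poly" where
  "pmp_poly \<tau> n = (\<Sum>\<sigma>\<in>permutations_of_set {1..n}. monom 1 (pmp \<tau> \<sigma>))"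

definition pmp_Wilf_equivalent :: "marked_pattern \<Rightarrow> marked_pattern \<Rightarrow> bool" where
  "pmp_Wilf_equivalent \<tau> \<tau>' \<longleftrightarrow>
     positional_marked_pattern \<tau> \<and> positional_marked_pattern \<tau>' \<and>
     (\<forall>n. pmp_poly \<tau> n = pmp_poly \<tau>' n)"

end

theory Submission
  imports Defs
begin

text \<open>
  Build a permutation by inserting its letters in decreasing order. The newly inserted letter \<open>a\<close>
  is smaller than all others, so inserting it leaves the matches at other letters
  unchanged, and \<open>a\<close> itself starts a match of \<open>123\<close> (of \<open>132\<close>) unless the letters to its right are
  decreasing (increasing). If \<open>d\<close> is the length of the longest decreasing (increasing)
  suffix of a word of length \<open>n\<close>, then the \<open>d + 1\<close> insertions that create no match yield words whose
  values of \<open>d\<close> are \<open>1, \<dots>, d + 1\<close>, each once, and the other \<open>n - d\<close> insertions keep \<open>d\<close>.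
  So both patterns have the same generating tree.
\<close>

section \<open>Two statistics and their change when a smallest letter is inserted\<close>

text \<open>Counts the letters that start a match: there is none exactly when \<open>r\<close> sorts
  the larger letters to the right, so \<open>(>)\<close> stands for 123 and \<open>(<)\<close> for
  132.\<close>

fun unsorted_starts :: "(nat \<Rightarrow> nat \<Rightarrow> bool) \<Rightarrow> nat list \<Rightarrow> nat" where
  "unsorted_starts r [] = 0"
| "unsorted_starts r (x # xs) =
     (if sorted_wrt r (filter (\<lambda>y. x < y) xs) then 0 else 1) + unsorted_starts r xs"

fun sorted_suffix :: "('a \<Rightarrow> 'a \<Rightarrow> bool) \<Rightarrow> 'a list \<Rightarrow> nat" where
  "sorted_suffix r [] = 0"
| "sorted_suffix r (x # xs) =
     (if sorted_wrt r (x # xs) then Suc (length xs) else sorted_suffix r xs)"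

lemma sorted_suffix_le: "sorted_suffix r xs \<le> length xs"
  by (induction xs) auto

lemma sorted_suffix_eq_length: "sorted_wrt r xs \<Longrightarrow> sorted_suffix r xs = length xs"
  by (cases xs) auto

lemma sorted_suffix_append_unsorted:
  "\<not> sorted_wrt r ys \<Longrightarrow> sorted_suffix r (xs @ ys) = sorted_suffix r ys"
  by (induction xs) (auto simp: sorted_wrt_append)

lemma sorted_suffix_less_length: "\<not> sorted_wrt r ys \<Longrightarrow> sorted_suffix r ys < length ys"
  by (induction ys) (auto simp: less_Suc_eq_le sorted_suffix_le)

lemma length_le_sorted_suffix_append:
  "sorted_wrt r ys \<Longrightarrow> length ys \<le> sorted_suffix r (xs @ ys)"
  by (induction xs) (auto simp: sorted_suffix_eq_length)

text \<open>The sorted suffixes are those no longer than the longest one, so the insertion places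
  without a match are those nearest the end.\<close>

lemma sorted_wrt_suffix_iff:
  "sorted_wrt r ys \<longleftrightarrow> length ys \<le> sorted_suffix r (xs @ ys)"
  using length_le_sorted_suffix_append sorted_suffix_append_unsorted sorted_suffix_less_length
  by (metis linorder_not_le)

text \<open>The filter at \<open>a\<close> keeps all of \<open>ys\<close>, while the filter at a
  letter of \<open>xs\<close> discards \<open>a\<close>.\<close>

lemma unsorted_starts_insert:
  assumes "\<forall>x\<in>set (xs @ ys). a < x"
  shows "unsorted_starts r (xs @ a # ys) =
    (if sorted_wrt r ys then 0 else 1) + unsorted_starts r (xs @ ys)"
  using assms
proof (induction xs)
  case Nil
  then have "filter (\<lambda>y. a < y) ys = ys"
    by (auto simp: filter_id_conv)
  then show ?case by simp
next
  case (Cons x xs)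
  then have "\<not> x < a" by (auto simp: less_not_sym)
  with Cons show ?case by simp
qed

text \<open>The longest sorted suffix starts inside \<open>ys\<close>, beyond the place of
  insertion.\<close>

lemma sorted_suffix_insert_unsorted:
  assumes "\<not> sorted_wrt r ys"
  shows "sorted_suffix r (xs @ a # ys) = sorted_suffix r (xs @ ys)"
  using assms sorted_suffix_append_unsorted[of r ys xs]
    sorted_suffix_append_unsorted[of r ys "xs @ [a]"] by simp

text \<open>\<open>a\<close> extends the increasing \<open>ys\<close>, and any letter before
  \<open>a\<close> exceeds it and breaks the order.\<close>

lemma sorted_suffix_less_insert:
  fixes a :: "'a :: linorder"
  assumes "\<forall>x\<in>set (xs @ ys). a < x" and "sorted_wrt (<) ys"
  shows "sorted_suffix (<) (xs @ a # ys) = Suc (length ys)"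
  using assms by (induction xs) (auto simp: less_not_sym sorted_wrt_append)

lemma sorted_suffix_greater_snoc:
  fixes a :: "'a :: linorder"
  assumes "\<And>x. x \<in> set xs \<Longrightarrow> a < x"
  shows "sorted_suffix (>) (xs @ [a]) = Suc (sorted_suffix (>) xs)"
  using assms by (induction xs) (auto simp: sorted_wrt_append)

text \<open>A larger letter follows \<open>a\<close>, so the decreasing suffix stops right after
  \<open>a\<close>. With \<open>ys\<close> empty, \<open>a\<close> would instead extend the
  suffix.\<close>

lemma sorted_suffix_greater_insert:
  fixes a :: "'a :: linorder"
  assumes "\<forall>x\<in>set (xs @ ys). a < x" and "sorted_wrt (>) ys" and "ys \<noteq> []"
  shows "sorted_suffix (>) (xs @ a # ys) = length ys"
proof -
  have "\<not> sorted_wrt (>) (a # ys)"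
    using assms by (cases ys) (auto simp: less_not_sym)
  then have "sorted_suffix (>) (xs @ a # ys) = sorted_suffix (>) (a # ys)"
    by (rule sorted_suffix_append_unsorted)
  with \<open>\<not> sorted_wrt (>) (a # ys)\<close> assms show ?thesis
    by (simp add: sorted_suffix_eq_length del: sorted_wrt.simps)
qed

section \<open>Permutations obtained by inserting one letter\<close>

text \<open>Counting from the right makes \<open>j\<close> the number of letters after
  \<open>a\<close>, to be compared with the length of the sorted suffix.\<close>

definition insert_before_last :: "'a \<Rightarrow> nat \<Rightarrow> 'a list \<Rightarrow> 'a list" where
  "insert_before_last a j w = take (length w - j) w @ a # drop (length w - j) w"

lemma bij_betw_insert_before_last:
  assumes "finite A" and "a \<notin> A"
  shows "bij_betw (\<lambda>(w, j). insert_before_last a j w)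
    (permutations_of_set A \<times> {..card A}) (permutations_of_set (insert a A))"
proof (rule bij_betw_imageI)
  show "inj_on (\<lambda>(w, j). insert_before_last a j w) (permutations_of_set A \<times> {..card A})"
  proof (rule inj_onI)
    fix p q
    assume "p \<in> permutations_of_set A \<times> {..card A}" "q \<in> permutations_of_set A \<times> {..card A}"
      and "(\<lambda>(w, j). insert_before_last a j w) p = (\<lambda>(w, j). insert_before_last a j w) q"
    then obtain v i w j where p: "p = (v, i)" and q: "q = (w, j)"
      and v: "v \<in> permutations_of_set A" "i \<in> {..card A}"
      and w: "w \<in> permutations_of_set A" "j \<in> {..card A}"
      and eq: "insert_before_last a i v = insert_before_last a j w" by auto
    have len: "length v = card A" "length w = card A"
      using v w by (auto dest: length_finite_permutations_of_set)
    have *: "a \<notin> set v" "a \<notin> set w"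
      using v w assms by (auto dest: permutations_of_setD)
    \<comment> \<open>As \<open>a\<close> occurs in neither word, its single occurrence determines
      both sides.\<close>
    then have "take (length v - i) v = take (length w - j) w \<and> drop (length v - i) v = drop (length w - j) w"
      using eq unfolding insert_before_last_def
      by (subst (asm) append_Cons_eq_iff) (auto dest: in_set_takeD in_set_dropD)
    moreover from this have "length (drop (length v - i) v) = length (drop (length w - j) w)" by simp
    \<comment> \<open>Since \<open>i\<close> and \<open>j\<close> are at most the word length, the
      right-hand parts have lengths \<open>i\<close> and \<open>j\<close>.\<close>
    ultimately show "p = q"
      unfolding p q using len v w by (metis append_take_drop_id atMost_iff diff_diff_cancel length_drop)
  qed
  show "(\<lambda>(w, j). insert_before_last a j w) ` (permutations_of_set A \<times> {..card A}) =
    permutations_of_set (insert a A)"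
  proof (intro equalityI subsetI)
    fix u assume "u \<in> (\<lambda>(w, j). insert_before_last a j w) ` (permutations_of_set A \<times> {..card A})"
    then obtain w j where w: "w \<in> permutations_of_set A" and u: "u = insert_before_last a j w"
      by auto
    define xs ys where "xs = take (length w - j) w" and "ys = drop (length w - j) w"
    have "w = xs @ ys" "u = xs @ a # ys"
      by (simp_all add: xs_def ys_def u insert_before_last_def)
    then show "u \<in> permutations_of_set (insert a A)"
      using w assms by (auto simp: permutations_of_set_def)
  next
    fix u assume u: "u \<in> permutations_of_set (insert a A)"
    then have "a \<in> set u" by (auto dest: permutations_of_setD)
    then obtain xs ys where xy: "u = xs @ a # ys" by (auto dest: split_list)
    have w: "xs @ ys \<in> permutations_of_set A"
      using u assms by (auto simp: permutations_of_set_def xy)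
    then have "length ys \<le> card A"
      by (auto dest: length_finite_permutations_of_set)
    moreover have "u = insert_before_last a (length ys) (xs @ ys)"
      by (simp add: insert_before_last_def xy)
    ultimately show "u \<in> (\<lambda>(w, j). insert_before_last a j w) ` (permutations_of_set A \<times> {..card A})"
      using w by force
  qed
qed

lemma sum_permutations_of_set_insert:
  fixes f :: "'a list \<Rightarrow> 'b :: comm_monoid_add"
  assumes "finite A" and "a \<notin> A"
  shows "sum f (permutations_of_set (insert a A)) =
    (\<Sum>w\<in>permutations_of_set A. \<Sum>j\<le>card A. f (insert_before_last a j w))"
  using sum.reindex_bij_betw[OF bij_betw_insert_before_last[OF assms], of f]
  by (simp add: sum.cartesian_product case_prod_unfold)

section \<open>The generating tree and equidistribution\<close>

text \<open>The succession rule of the tree: its right side depends on \<open>r\<close> only through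
  the label \<open>(c, d)\<close>.\<close>

lemma sum_insert_before_last:
  fixes h :: "nat \<Rightarrow> nat \<Rightarrow> 'b :: comm_monoid_add"
  assumes r: "r = (<) \<or> r = (>)" and a: "\<And>x. x \<in> set w \<Longrightarrow> a < x"
  defines "c \<equiv> unsorted_starts r w" and "d \<equiv> sorted_suffix r w"
  shows "(\<Sum>j\<le>length w. h (unsorted_starts r (insert_before_last a j w))
                         (sorted_suffix r (insert_before_last a j w))) =
    (\<Sum>i\<le>d. h c (Suc i)) + (\<Sum>j\<in>{d<..length w}. h (Suc c) d)"
proof -
  let ?u = "\<lambda>j. insert_before_last a j w"
  let ?f = "\<lambda>j. h (unsorted_starts r (?u j)) (sorted_suffix r (?u j))"
  have d: "d \<le> length w" unfolding d_def by (rule sorted_suffix_le)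
  have split: "\<exists>xs ys. w = xs @ ys \<and> length ys = j \<and> ?u j = xs @ a # ys" if "j \<le> length w" for j
    using that by (intro exI[of _ "take (length w - j) w"] exI[of _ "drop (length w - j) w"])
      (simp add: insert_before_last_def)
  have large: "?f j = h (Suc c) d" if j: "j \<in> {d<..length w}" for j
  proof -
    obtain xs ys where xy: "w = xs @ ys" "length ys = j" "?u j = xs @ a # ys"
      using split[of j] j by auto
    have "\<not> sorted_wrt r ys"
      using j sorted_wrt_suffix_iff[of r ys xs] by (simp add: xy d_def)
    moreover have a': "\<forall>x\<in>set (xs @ ys). a < x" using a xy by simp
    ultimately have "unsorted_starts r (?u j) = Suc c" "sorted_suffix r (?u j) = d"
      unfolding xy(3) unfolding c_def d_def xy(1)
      by (simp_all add: unsorted_starts_insert[OF a'] sorted_suffix_insert_unsorted)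
    then show ?thesis by simp
  qed
  \<comment> \<open>For j = 0, ..., d the new suffix lengths are 1, 2, ..., d + 1 under
    \<open>(<)\<close>, but d + 1, 1, ..., d under \<open>(>)\<close>.\<close>
  have small: "unsorted_starts r (?u j) = c \<and> sorted_suffix r (?u j) =
      (if r = (<) then Suc j else if j = 0 then Suc d else j)" if j: "j \<le> d" for j
  proof -
    obtain xs ys where xy: "w = xs @ ys" "length ys = j" "?u j = xs @ a # ys"
      using split[of j] j d by auto
    have s: "sorted_wrt r ys"
      using j sorted_wrt_suffix_iff[of r ys xs] by (simp add: xy d_def)
    have a': "\<forall>x\<in>set (xs @ ys). a < x" using a xy by simp
    have "sorted_suffix r (?u j) = (if r = (<) then Suc j else if j = 0 then Suc d else j)"
    proof (cases "r = (<)")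
      case True
      with sorted_suffix_less_insert[OF a'] s xy show ?thesis by simp
    next
      case False
      with r have r': "r = (>)" by simp
      show ?thesis
      proof (cases "j = 0")
        case True
        with xy a' False sorted_suffix_greater_snoc[of xs a] show ?thesis
          by (simp add: d_def r')
      next
        case False
        with xy sorted_suffix_greater_insert[OF a'] s \<open>r \<noteq> (<)\<close> show ?thesis
          by (force simp: r')
      qed
    qed
    moreover have "unsorted_starts r (?u j) = c"
      unfolding xy(3) unfolding c_def xy(1) using s by (simp add: unsorted_starts_insert[OF a'])
    ultimately show ?thesis by simp
  qed
  have "sum ?f {..d} = (\<Sum>i\<le>d. h c (Suc i))"
  proof (cases "r = (<)")
    case True
    with small show ?thesis by (intro sum.cong) auto
  next
    case False
    with small have "sum ?f {..d} = (\<Sum>j\<le>d. h c (if j = 0 then Suc d else j))"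
      by (intro sum.cong) auto
    \<comment> \<open>Splitting off \<open>j = 0\<close> shifts the other indices by one; its value
      \<open>Suc d\<close> then supplies the last summand.\<close>
    also have "\<dots> = h c (Suc d) + (\<Sum>j<d. h c (Suc j))"
      by (simp add: sum.atMost_shift)
    also have "\<dots> = (\<Sum>i\<le>d. h c (Suc i))"
      by (simp add: lessThan_Suc_atMost[symmetric] add.commute)
    finally show ?thesis .
  qed
  moreover have "sum ?f {d<..length w} = (\<Sum>j\<in>{d<..length w}. h (Suc c) d)"
    using large by (rule sum.cong[OF refl])
  moreover have "{..length w} = {..d} \<union> {d<..length w}" using d by auto
  moreover have "sum ?f ({..d} \<union> {d<..length w}) = sum ?f {..d} + sum ?f {d<..length w}"
    by (rule sum.union_disjoint) auto
  ultimately show ?thesis by simp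
qed

text \<open>The induction adds a new smallest element, so it passes through sets that are not
  initial segments, and its step replaces the weight \<open>h\<close> by another one.\<close>

lemma sum_permutations_less_eq_greater:
  fixes h :: "nat \<Rightarrow> nat \<Rightarrow> 'b :: comm_monoid_add" and A :: "nat set"
  assumes "finite A"
  shows "(\<Sum>w\<in>permutations_of_set A. h (unsorted_starts (<) w) (sorted_suffix (<) w)) =
         (\<Sum>w\<in>permutations_of_set A. h (unsorted_starts (>) w) (sorted_suffix (>) w))"
  using assms
proof (induction A arbitrary: h rule: finite_linorder_min_induct)
  case empty
  then show ?case by simp
next
  case (insert a A)
  \<comment> \<open>\<open>T c d\<close> totals \<open>h\<close> over all insertions into a word
    with label \<open>(c, d)\<close>. It does not mention \<open>r\<close>, so the induction
    hypothesis for \<open>T\<close> closes the step.\<close>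
  define T where "T = (\<lambda>c d. (\<Sum>i\<le>d. h c (Suc i)) + (\<Sum>j\<in>{d<..card A}. h (Suc c) d))"
  have "(\<Sum>w\<in>permutations_of_set (insert a A). h (unsorted_starts r w) (sorted_suffix r w)) =
      (\<Sum>w\<in>permutations_of_set A. T (unsorted_starts r w) (sorted_suffix r w))"
    if r: "r = (<) \<or> r = (>)" for r
  proof -
    have "(\<Sum>w\<in>permutations_of_set (insert a A). h (unsorted_starts r w) (sorted_suffix r w)) =
      (\<Sum>w\<in>permutations_of_set A. \<Sum>j\<le>card A.
         h (unsorted_starts r (insert_before_last a j w)) (sorted_suffix r (insert_before_last a j w)))"
      by (rule sum_permutations_of_set_insert) (use insert.hyps in auto)
    also have "\<dots> = (\<Sum>w\<in>permutations_of_set A. T (unsorted_starts r w) (sorted_suffix r w))"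
    proof (rule sum.cong[OF refl])
      fix w assume w: "w \<in> permutations_of_set A"
      then have "length w = card A" "\<And>x. x \<in> set w \<Longrightarrow> a < x"
        using insert.hyps by (auto dest: length_finite_permutations_of_set permutations_of_setD)
      with sum_insert_before_last[OF r, of w a h]
      show "(\<Sum>j\<le>card A. h (unsorted_starts r (insert_before_last a j w))
          (sorted_suffix r (insert_before_last a j w))) = T (unsorted_starts r w) (sorted_suffix r w)"
        by (simp add: T_def)
    qed
    finally show ?thesis .
  qed
  with insert.IH[of T] show ?case by simp
qed

section \<open>From the recursive count to positions\<close>

text \<open>Retains the indices of the unfiltered word, so that pairs of filtered letters need no
  reindexing.\<close>

lemma sorted_wrt_filter_iff:
  "sorted_wrt r (filter P xs) \<longleftrightarrow> sorted_wrt (\<lambda>a b. P a \<longrightarrow> P b \<longrightarrow> r a b) xs"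
  by (induction xs) auto

text \<open>The head decides position 1, and the other positions are those of the tail shifted by
  one.\<close>

lemma unsorted_starts_eq_card:
  "unsorted_starts r w = card {l \<in> {1..length w}. \<exists>i j. l < i \<and> i < j \<and> j \<le> length w \<and>
     letter w l < letter w i \<and> letter w l < letter w j \<and> \<not> r (letter w i) (letter w j)}"
proof (induction w)
  case Nil
  then show ?case by simp
next
  case (Cons x xs)
  let ?P = "\<lambda>w l. \<exists>i j. l < i \<and> i < j \<and> j \<le> length w \<and>
     letter w l < letter w i \<and> letter w l < letter w j \<and> \<not> r (letter w i) (letter w j)"
  \<comment> \<open>Natural subtraction makes \<open>letter\<close> read index 0 as index 1, so the
    shift needs \<open>k > 0\<close>.\<close>
  have letter_Cons: "letter (x # xs) (Suc k) = letter xs k" if "k > 0" for k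
    using that by (cases k) (auto simp: letter_def)
  have step: "?P (x # xs) (Suc l) \<longleftrightarrow> ?P xs l" if "l > 0" for l
  proof
    assume "?P (x # xs) (Suc l)"
    then obtain i j where "Suc l < i" "i < j" "j \<le> length (x # xs)"
      "letter (x # xs) (Suc l) < letter (x # xs) i" "letter (x # xs) (Suc l) < letter (x # xs) j"
      "\<not> r (letter (x # xs) i) (letter (x # xs) j)" by blast
    then show "?P xs l" using that
      by (intro exI[of _ "i - 1"] exI[of _ "j - 1"]) (cases i; cases j; auto simp: letter_Cons)
  next
    assume "?P xs l"
    then obtain i j where "l < i" "i < j" "j \<le> length xs"
      "letter xs l < letter xs i" "letter xs l < letter xs j"
      "\<not> r (letter xs i) (letter xs j)" by blast
    then show "?P (x # xs) (Suc l)" using that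
      by (intro exI[of _ "Suc i"] exI[of _ "Suc j"]) (auto simp: letter_Cons)
  qed
  have first: "?P (x # xs) 1 \<longleftrightarrow> \<not> sorted_wrt r (filter (\<lambda>y. x < y) xs)"
  proof
    assume "?P (x # xs) 1"
    then obtain i j where "1 < i" "i < j" "j \<le> length (x # xs)"
      "letter (x # xs) 1 < letter (x # xs) i" "letter (x # xs) 1 < letter (x # xs) j"
      "\<not> r (letter (x # xs) i) (letter (x # xs) j)" by blast
    \<comment> \<open>One unit of the shift by 2 is for counting from 1, the other for the removed
      head.\<close>
    then have "i - 2 < j - 2" "j - 2 < length xs" "x < xs ! (i - 2)" "x < xs ! (j - 2)"
      "\<not> r (xs ! (i - 2)) (xs ! (j - 2))"
      by (auto simp: letter_def nth_Cons' numeral_2_eq_2)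
    then show "\<not> sorted_wrt r (filter (\<lambda>y. x < y) xs)"
      unfolding sorted_wrt_filter_iff by (auto dest: sorted_wrt_nth_less)
  next
    assume "\<not> sorted_wrt r (filter (\<lambda>y. x < y) xs)"
    then obtain i j where "i < j" "j < length xs" "x < xs ! i" "x < xs ! j"
      "\<not> r (xs ! i) (xs ! j)"
      unfolding sorted_wrt_filter_iff unfolding sorted_wrt_iff_nth_less by auto
    then show "?P (x # xs) 1"
      by (intro exI[of _ "i + 2"] exI[of _ "j + 2"]) (auto simp: letter_def)
  qed
  have "{l \<in> {1..length (x # xs)}. ?P (x # xs) l} =
    (if sorted_wrt r (filter (\<lambda>y. x < y) xs) then {} else {1}) \<union> Suc ` {l \<in> {1..length xs}. ?P xs l}"
    (is "?L = ?R")
  proof (rule set_eqI)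
    fix l
    consider "l = 0" | "l = 1" | k where "l = Suc k" "k > 0"
      by (cases l) auto
    then show "l \<in> ?L \<longleftrightarrow> l \<in> ?R"
    proof cases
      case 1
      then show ?thesis by auto
    next
      case 2
      then show ?thesis using first by auto
    next
      case (3 k)
      then show ?thesis using step[of k] by (simp add: inj_image_mem_iff)
    qed
  qed
  moreover have "card ?R =
    (if sorted_wrt r (filter (\<lambda>y. x < y) xs) then 0 else 1) + card {l \<in> {1..length xs}. ?P xs l}"
    by (subst card_Un_disjoint) (auto simp: card_image)
  ultimately show ?case using Cons by simp
qed

section \<open>Ranks and matches of patterns of length three\<close>

text \<open>If \<open>a < b\<close>, then \<open>b\<close> itself is counted only on the right; the
  converse is monotonicity of the count. Hence the ranks in \<open>red\<close> are ordered as the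
  letters are.\<close>

lemma card_atMost_less_iff:
  fixes a b :: "'a :: linorder"
  assumes "finite S" and "b \<in> S"
  shows "card {x \<in> S. x \<le> a} < card {x \<in> S. x \<le> b} \<longleftrightarrow> a < b"
proof
  assume "a < b"
  with assms have "{x \<in> S. x \<le> a} \<subseteq> {x \<in> S. x \<le> b}"
    and "b \<in> {x \<in> S. x \<le> b} - {x \<in> S. x \<le> a}" by auto
  then have "{x \<in> S. x \<le> a} \<subset> {x \<in> S. x \<le> b}" by blast
  then show "card {x \<in> S. x \<le> a} < card {x \<in> S. x \<le> b}"
    using assms by (intro psubset_card_mono) auto
next
  assume *: "card {x \<in> S. x \<le> a} < card {x \<in> S. x \<le> b}"
  show "a < b"
  proof (rule ccontr)
    assume "\<not> a < b"
    then have "card {x \<in> S. x \<le> b} \<le> card {x \<in> S. x \<le> a}"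
      using assms by (intro card_mono) auto
    with * show False by simp
  qed
qed

lemma red_eq_123_iff: "red [a, b, c] = [1, 2, 3] \<longleftrightarrow> a < b \<and> b < c"
proof
  assume "red [a, b, c] = [1, 2, 3]"
  then have "card {x \<in> set [a, b, c]. x \<le> a} = 1" "card {x \<in> set [a, b, c]. x \<le> b} = 2"
    "card {x \<in> set [a, b, c]. x \<le> c} = 3"
    unfolding red_def by (simp_all del: set_simps)
  then show "a < b \<and> b < c"
    using card_atMost_less_iff[of "set [a, b, c]" b a] card_atMost_less_iff[of "set [a, b, c]" c b]
    by (simp del: set_simps) simp
next
  assume *: "a < b \<and> b < c"
  then have "{x \<in> {a, b, c}. x \<le> a} = {a}" "{x \<in> {a, b, c}. x \<le> b} = {a, b}"
    "{x \<in> {a, b, c}. x \<le> c} = {a, b, c}" by auto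
  with * show "red [a, b, c] = [1, 2, 3]" unfolding red_def by simp
qed

text \<open>Exchanging the last two letters exchanges their ranks, as the set of letters stays the
  same.\<close>

lemma red_eq_132_iff: "red [a, b, c] = [1, 3, 2] \<longleftrightarrow> a < c \<and> c < b"
proof -
  have "red [a, b, c] = [1, 3, 2] \<longleftrightarrow> red [a, c, b] = [1, 2, 3]"
    unfolding red_def by (auto simp: insert_commute)
  then show ?thesis by (simp only: red_eq_123_iff)
qed

text \<open>The list of positions has three entries and the underlined one comes first, so it is
  \<open>[l, i, j]\<close>.\<close>

lemma has_match_at_length_3_iff:
  assumes "length p = 3"
  shows "has_match_at (Marked p 1) w l \<longleftrightarrow>
    (\<exists>i j. 1 \<le> l \<and> l < i \<and> i < j \<and> j \<le> length w \<and> red [letter w l, letter w i, letter w j] = p)"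
proof
  assume "has_match_at (Marked p 1) w l"
  then obtain ps where "length ps = 3" and ps: "set ps \<subseteq> {1..length w}" "sorted_wrt (<) ps"
    "letter ps 1 = l" "red (map (letter w) ps) = p"
    using assms by (auto simp: has_match_at_def)
  then obtain k i j where "ps = [k, i, j]"
    by (auto simp: numeral_3_eq_3 length_Suc_conv)
  with ps show "\<exists>i j. 1 \<le> l \<and> l < i \<and> i < j \<and> j \<le> length w \<and>
      red [letter w l, letter w i, letter w j] = p"
    by (intro exI[of _ i] exI[of _ j]) (auto simp: letter_def)
next
  assume "\<exists>i j. 1 \<le> l \<and> l < i \<and> i < j \<and> j \<le> length w \<and> red [letter w l, letter w i, letter w j] = p"
  then obtain i j where "1 \<le> l" "l < i" "i < j" "j \<le> length w"
    "red [letter w l, letter w i, letter w j] = p" by blast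
  then show "has_match_at (Marked p 1) w l"
    unfolding has_match_at_def using assms
    by (intro exI[of _ "[l, i, j]"]) (auto simp: letter_def)
qed

text \<open>\<open>r\<close> is the relation that the last two letters of a match violate. Violating
  \<open>(<)\<close> or \<open>(>)\<close> means the reverse strict order only for different
  letters, hence \<open>b \<noteq> c\<close>.\<close>

lemma pmp_eq_unsorted_starts:
  assumes w: "distinct w" and p: "length p = 3"
    and red: "\<And>a b c. b \<noteq> c \<Longrightarrow> red [a, b, c] = p \<longleftrightarrow> a < b \<and> a < c \<and> \<not> r b c"
  shows "pmp (Marked p 1) w = unsorted_starts r w"
proof -
  have "has_match_at (Marked p 1) w l \<longleftrightarrow> (\<exists>i j. l < i \<and> i < j \<and> j \<le> length w \<and>
     letter w l < letter w i \<and> letter w l < letter w j \<and> \<not> r (letter w i) (letter w j))"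
    if l: "l \<in> {1..length w}" for l
  proof -
    have "red [letter w l, letter w i, letter w j] = p \<longleftrightarrow>
        letter w l < letter w i \<and> letter w l < letter w j \<and> \<not> r (letter w i) (letter w j)"
      if "l < i" "i < j" "j \<le> length w" for i j
      \<comment> \<open>Distinctness of \<open>w\<close> makes the letters at positions
        \<open>i < j\<close> different.\<close>
      by (rule red) (use l that w in \<open>auto simp: letter_def nth_eq_iff_index_eq\<close>)
    then show ?thesis
      unfolding has_match_at_length_3_iff[OF p] using l by auto
  qed
  then show ?thesis
    unfolding pmp_def unsorted_starts_eq_card by (intro arg_cong[where f = card] Collect_cong) blast
qed

lemma pmp_123: "distinct w \<Longrightarrow> pmp (Marked [1, 2, 3] 1) w = unsorted_starts (>) w"
  by (rule pmp_eq_unsorted_starts) (simp, simp, subst red_eq_123_iff, auto)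

lemma pmp_132: "distinct w \<Longrightarrow> pmp (Marked [1, 3, 2] 1) w = unsorted_starts (<) w"
  by (rule pmp_eq_unsorted_starts) (simp, simp, subst red_eq_132_iff, auto)

theorem theorem1:
  shows "pmp_Wilf_equivalent (Marked [1, 2, 3] 1) (Marked [1, 3, 2] 1)"
proof -
  have "pmp_poly (Marked [1, 2, 3] 1) n = pmp_poly (Marked [1, 3, 2] 1) n" for n
  proof -
    have "pmp_poly (Marked [1, 2, 3] 1) n =
        (\<Sum>w\<in>permutations_of_set {1..n}. monom 1 (unsorted_starts (>) w))"
      unfolding pmp_poly_def by (intro sum.cong) (auto dest: permutations_of_setD simp: pmp_123[simplified])
    also have "\<dots> = (\<Sum>w\<in>permutations_of_set {1..n}. monom 1 (unsorted_starts (<) w))"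
      \<comment> \<open>A weight that ignores the suffix length leaves the distribution of the match
        count.\<close>
      by (rule sum_permutations_less_eq_greater[symmetric, where h = "\<lambda>c d. monom 1 c"]) simp
    also have "\<dots> = pmp_poly (Marked [1, 3, 2] 1) n"
      unfolding pmp_poly_def by (intro sum.cong) (auto dest: permutations_of_setD simp: pmp_132[simplified])
    finally show ?thesis .
  qed
  moreover have "{1..3} = {1, 2, 3 :: nat}" by auto
  ultimately show ?thesis
    by (auto simp: pmp_Wilf_equivalent_def positional_marked_pattern_def permutations_of_set_def)
qed

end
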